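(* Fix a state $x\in\mathbb{R}^n$. Let $u^*\in\mathbb{R}^m$ and $\delta_1^*,\delta_2^*\in\mathbb{R}$ be the control input and slack variables obtained by solving the three nested sub-problems of the Safety-first CLF-CBF QP at $x$ (see context). For $q>0$ consider the Unified CLF-CBF QP with weights $q,q^2$, $$\min_{(u,\delta_1,\delta_2)\in\mathbb{R}^m\times\mathbb{R}\times\mathbb{R}}\ (u-k(x))^TH(u-k(x))+q\,\delta_1^2+q^2\,\delta_2^2$$ subject to $$L_fV(x)+L_gV(x)u+\lambda V(x)\le\delta_1,\qquad L_fh(x)+L_gh(x)u+\gamma h(x)\ge\delta_2,\qquad u\in\mathcal{U}.$$ Then $(u^*,\delta_1^*,\delta_2^* )$ is the optimal solution of this problem in the limit $q\to+\infty$; that is, if $(u_q,\delta_{1,q},\delta_{2,q})$ denotes the optimal solution for weight $q$, then $(u_q,\delta_{1,q},\delta_{2,q})\to(u^*,\delta_1^*,\delta_2^* )$ as $q\to+\infty$.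
   Context: Setting: a control-affine system $\dot x=f(x)+g(x)u$ with $x\in\mathbb{R}^n$, $u\in\mathbb{R}^m$, $f:\mathbb{R}^n\to\mathbb{R}^n$ and $g:\mathbb{R}^n\to\mathbb{R}^{n\times m}$ locally Lipschitz; the input constraint set $\mathcal{U}\subset\mathbb{R}^m$ is a nonempty (closed) convex polytope $\{u: Au\preceq b\}$; $k:\mathbb{R}^n\to\mathbb{R}^m$ is a nominal controller; $V,h:\mathbb{R}^n\to\mathbb{R}$ are continuously differentiable (a control Lyapunov function and a control barrier function); $H\in\mathbb{R}^{m\times m}$ is symmetric positive definite; $\lambda,\gamma>0$. Lie derivatives: $L_fV(x)=\nabla V(x)^Tf(x)\in\mathbb{R}$, $L_gV(x)=\nabla V(x)^Tg(x)\in\mathbb{R}^{1\times m}$, and similarly for $h$. Safety-first CLF-CBF QP at $x$: Sub-problem 1: $\delta_2^*$ is the $\delta_2$-component of a minimizer of $\delta_2^2$ over all $(u,\delta_1,\delta_2)$ with $L_fV(x)+L_gV(x)u+\lambda V(x)\le\delta_1$, $L_fh(x)+L_gh(x)u+\gamma h(x)\ge\delta_2$, $u\in\mathcal{U}$. Sub-problem 2: $\delta_1^*$ is the $\delta_1$-component of a minimizer of $\delta_1^2$ over all $(u,\delta_1)$ with $L_fV(x)+L_gV(x)u+\lambda V(x)\le\delta_1$, $L_fh(x)+L_gh(x)u+\gamma h(x)\ge\delta_2^*$, $u\in\mathcal{U}$. Sub-problem 3: $u^*$ is the minimizer of $(u-k(x))^TH(u-k(x))$ over all $u$ with $L_fV(x)+L_gV(x)u+\lambda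 V(x)\le\delta_1^*$, $L_fh(x)+L_gh(x)u+\gamma h(x)\ge\delta_2^*$, $u\in\mathcal{U}$. *)

theory Defs
  imports "HOL-Analysis.Analysis"
begin

definition gradient :: "(real ^ 'n \<Rightarrow> real) \<Rightarrow> real ^ 'n \<Rightarrow> real ^ 'n" where
  "gradient F x = (THE D. GDERIV F x :> D)"

definition continuously_differentiable :: "(real ^ 'n \<Rightarrow> real) \<Rightarrow> bool" where
  "continuously_differentiable F \<longleftrightarrow>
     (\<forall>x. F differentiable (at x)) \<and> continuous_on UNIV (gradient F)"

definition lie_f :: "(real ^ 'n \<Rightarrow> real ^ 'n) \<Rightarrow> (real ^ 'n \<Rightarrow> real) \<Rightarrow> real ^ 'n \<Rightarrow> real" where
  "lie_f f F x = gradient F x \<bullet> f x"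

text \<open>The Lie derivative along \<open>g\<close> is a row vector; it is represented by a vector, and its
  product with an input \<open>u\<close> is the inner product.\<close>

definition lie_g :: "(real ^ 'n \<Rightarrow> real ^ 'm ^ 'n) \<Rightarrow> (real ^ 'n \<Rightarrow> real) \<Rightarrow> real ^ 'n \<Rightarrow> real ^ 'm" where
  "lie_g g F x = gradient F x v* g x"

definition symmetric_positive_definite :: "real ^ 'm ^ 'm \<Rightarrow> bool" where
  "symmetric_positive_definite H \<longleftrightarrow>
     transpose H = H \<and> (\<forall>v. v \<noteq> 0 \<longrightarrow> v \<bullet> (H *v v) > 0)"

text \<open>The order on vectors is componentwise. The set need not be bounded.\<close>

definition input_set :: "real ^ 'm ^ 'p \<Rightarrow> real ^ 'p \<Rightarrow> (real ^ 'm) set" where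
  "input_set A b = {u. A *v u \<le> b}"

definition control_cost :: "real ^ 'm ^ 'm \<Rightarrow> (real ^ 'n \<Rightarrow> real ^ 'm) \<Rightarrow> real ^ 'n \<Rightarrow> real ^ 'm \<Rightarrow> real" where
  "control_cost H k x u = (u - k x) \<bullet> (H *v (u - k x))"

definition feasible ::
  "(real ^ 'n \<Rightarrow> real ^ 'n) \<Rightarrow> (real ^ 'n \<Rightarrow> real ^ 'm ^ 'n) \<Rightarrow>
   (real ^ 'n \<Rightarrow> real) \<Rightarrow> (real ^ 'n \<Rightarrow> real) \<Rightarrow> real \<Rightarrow> real \<Rightarrow> (real ^ 'm) set \<Rightarrow>
   real ^ 'n \<Rightarrow> real ^ 'm \<Rightarrow> real \<Rightarrow> real \<Rightarrow> bool" where
  "feasible f g V h lam gam U x u d1 d2 \<longleftrightarrow>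
     lie_f f V x + lie_g g V x \<bullet> u + lam * V x \<le> d1 \<and>
     lie_f f h x + lie_g g h x \<bullet> u + gam * h x \<ge> d2 \<and>
     u \<in> U"

text \<open>The three conjuncts are the nested sub-problems. In the first two, only the slack component
  of a minimizer is retained.\<close>

definition safety_first_solution ::
  "(real ^ 'n \<Rightarrow> real ^ 'n) \<Rightarrow> (real ^ 'n \<Rightarrow> real ^ 'm ^ 'n) \<Rightarrow>
   (real ^ 'n \<Rightarrow> real) \<Rightarrow> (real ^ 'n \<Rightarrow> real) \<Rightarrow> real \<Rightarrow> real \<Rightarrow> (real ^ 'm) set \<Rightarrow>
   real ^ 'm ^ 'm \<Rightarrow> (real ^ 'n \<Rightarrow> real ^ 'm) \<Rightarrow>
   real ^ 'n \<Rightarrow> (real ^ 'm) \<times> real \<times> real \<Rightarrow> bool" where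
  "safety_first_solution f g V h lam gam U H k x = (\<lambda>(us, d1s, d2s).
     (\<exists>u d1. is_arg_min (\<lambda>(u, d1, d2). d2\<^sup>2)
        (\<lambda>(u, d1, d2). feasible f g V h lam gam U x u d1 d2) (u, d1, d2s)) \<and>
     (\<exists>u. is_arg_min (\<lambda>(u, d1). d1\<^sup>2)
        (\<lambda>(u, d1). feasible f g V h lam gam U x u d1 d2s) (u, d1s)) \<and>
     is_arg_min (control_cost H k x)
        (\<lambda>u. feasible f g V h lam gam U x u d1s d2s) us)"

definition unified_solution ::
  "(real ^ 'n \<Rightarrow> real ^ 'n) \<Rightarrow> (real ^ 'n \<Rightarrow> real ^ 'm ^ 'n) \<Rightarrow>
   (real ^ 'n \<Rightarrow> real) \<Rightarrow> (real ^ 'n \<Rightarrow> real) \<Rightarrow> real \<Rightarrow> real \<Rightarrow> (real ^ 'm) set \<Rightarrow>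
   real ^ 'm ^ 'm \<Rightarrow> (real ^ 'n \<Rightarrow> real ^ 'm) \<Rightarrow>
   real ^ 'n \<Rightarrow> real \<Rightarrow> (real ^ 'm) \<times> real \<times> real \<Rightarrow> bool" where
  "unified_solution f g V h lam gam U H k x q =
     is_arg_min (\<lambda>(u, d1, d2). control_cost H k x u + q * d1\<^sup>2 + q\<^sup>2 * d2\<^sup>2)
       (\<lambda>(u, d1, d2). feasible f g V h lam gam U x u d1 d2)"

end

theory Submission imports Defs begin

text \<open>Comparing the weighted optimum with the safety-first solution gives \<open>d2 q \<longlonglongrightarrow> d2s\<close> and an upper
  bound for the limit of \<open>d1 q\<close>; the lower bound is the lower semicontinuity of the value of a linear
  program in its right-hand side. This comparison leaves \<open>q (d1s\<^sup>2 - (d1 q)\<^sup>2)\<close> merely bounded when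
  \<open>d2s = 0\<close>, so it does not bound the limit of the control cost by the cost of \<open>us\<close>. Instead, the
  projection of the feasible polyhedron onto the slacks is an open map onto its image, which yields
  competitors converging to \<open>us\<close> that have exactly the slacks of the weighted optimum. The first-order
  condition at \<open>us\<close>, again with lower semicontinuity of a linear program, turns convergence of the cost
  into convergence of the inputs.\<close>

section \<open>Local conical structure of polyhedra and of their linear images\<close>

text \<open>Of the finitely many halfspaces that cut out \<open>P\<close>, those with 0 on the
  boundary contain the whole cone, and those with 0 in the interior contain a neighbourhood of
  0.\<close>

lemma eventually_conic_hull_polyhedron:
  fixes P :: "'a::euclidean_space set"
  assumes "polyhedron P" "0 \<in> P"
  shows "\<forall>\<^sub>F w in nhds 0. w \<in> conic hull P \<longrightarrow> w \<in> P"
proof -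
  obtain F where F: "finite F" "P = \<Inter>F" "\<And>h. h \<in> F \<Longrightarrow> \<exists>a b. a \<noteq> 0 \<and> h = {x. a \<bullet> x \<le> b}"
    using assms(1) unfolding polyhedron_def by blast
  have "\<forall>\<^sub>F w in nhds 0. w \<in> conic hull P \<longrightarrow> w \<in> h" if h: "h \<in> F" for h
  proof -
    obtain a b where ab: "h = {x. a \<bullet> x \<le> b}" using F(3)[OF h] by blast
    have Ph: "P \<subseteq> h" using F(2) h by blast
    have "0 \<le> b" using Ph assms(2) ab by auto
    then consider "b = 0" | "0 < b" by linarith
    then show ?thesis
    proof cases
      case 1
      have "w \<in> h" if w: "w \<in> conic hull P" for w
      proof -
        obtain c x where "0 \<le> c" "x \<in> P" "w = c *\<^sub>R x"
          using w unfolding conic_hull_explicit mem_Collect_eq by (elim exE conjE) (rule that)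
        then show ?thesis using Ph ab 1 by (auto simp: mult_nonneg_nonpos)
      qed
      then show ?thesis by simp
    next
      case 2
      have "\<forall>\<^sub>F w in nhds 0. w \<in> {x. a \<bullet> x < b}"
        by (rule eventually_nhds_in_open) (use 2 in \<open>auto simp: open_halfspace_lt\<close>)
      then show ?thesis by eventually_elim (auto simp: ab)
    qed
  qed
  then have "\<forall>\<^sub>F w in nhds 0. \<forall>h\<in>F. w \<in> conic hull P \<longrightarrow> w \<in> h"
    using F(1) by (intro eventually_ball_finite ballI)
  then show ?thesis by eventually_elim (auto simp: F(2))
qed

text \<open>Truncating to a bounded neighbourhood of 0 does not change the cone generated at 0, and
  turns the image into a polytope.\<close>

lemma polyhedron_linear_image_cone:
  fixes T :: "'a::euclidean_space \<Rightarrow> 'b::euclidean_space"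
  assumes P: "polyhedron P" "0 \<in> P" and T: "linear T" and e: "0 < e"
  obtains K where "closed K" "T ` P \<subseteq> K"
    "\<And>c w. 0 \<le> c \<Longrightarrow> w \<in> K \<Longrightarrow> c *\<^sub>R w \<in> K"
    "\<forall>\<^sub>F w in nhds 0. w \<in> K \<longrightarrow> (\<exists>p\<in>P. norm p < e \<and> T p = w)"
proof -
  \<comment> \<open>A box inside the ball is used because intersecting with it keeps the set
    polyhedral; the radius \<open>e\<close> becomes the norm bound on preimages.\<close>
  obtain a b :: 'a where a: "0 \<in> box a b" "cbox a b \<subseteq> ball 0 e"
    using open_contains_cbox[of "ball (0::'a) e" 0] e by (metis centre_in_ball open_ball)
  define Q where "Q = P \<inter> cbox a b"
  have "polytope Q"
    unfolding Q_def polytope_eq_bounded_polyhedron using P(1)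
    by (simp add: bounded_Int)
  then have TQ: "polytope (T ` Q)" by (rule polytope_linear_image[OF T])
  have Q0: "0 \<in> Q" using P(2) a(1) box_subset_cbox unfolding Q_def by blast
  then have TQ0: "0 \<in> T ` Q" using linear_0[OF T] by force
  show thesis
  proof
    \<comment> \<open>Being a polytope matters here: a compact convex set with 0 on its boundary,
      such as a disc, can generate a cone that is not closed.\<close>
    show "closed (conic hull (T ` Q))"
      by (rule closed_conic_hull_strong) (use TQ in blast)
    show "T ` P \<subseteq> conic hull (T ` Q)"
    proof clarify
      fix p assume p: "p \<in> P"
      \<comment> \<open>Shrinking \<open>p\<close> towards 0 brings it into the box, convexity keeps
        it in \<open>P\<close>, and the cone undoes the scaling.\<close>
      have "((\<lambda>t. t *\<^sub>R p) \<longlongrightarrow> 0 *\<^sub>R p) (at_right 0)" by (intro tendsto_intros)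
      then have "\<forall>\<^sub>F t in at_right 0. t *\<^sub>R p \<in> box a b"
        using a(1) by (intro topological_tendstoD) auto
      moreover have "\<forall>\<^sub>F t in at_right 0. t \<in> {0<..<1::real}"
        by (rule eventually_at_right_real) simp
      ultimately have "\<forall>\<^sub>F t in at_right 0. t *\<^sub>R p \<in> box a b \<and> t \<in> {0<..<1::real}"
        by eventually_elim simp
      then obtain t :: real where t: "t *\<^sub>R p \<in> box a b" "0 < t" "t < 1"
        using eventually_happens'[OF trivial_limit_at_right_real] by force
      have "t *\<^sub>R p \<in> P"
        using convexD_alt[OF polyhedron_imp_convex[OF P(1)] P(2) p, of t] t by simp
      then have "T (t *\<^sub>R p) \<in> T ` Q" using t(1) box_subset_cbox by (auto simp: Q_def)
      moreover have "T p = inverse t *\<^sub>R T (t *\<^sub>R p)" using t(2) by (simp add: linear_cmul[OF T])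
      ultimately show "T p \<in> conic hull (T ` Q)"
        unfolding conic_hull_explicit using t(2)
        by (intro CollectI exI[of _ "inverse t"] exI[of _ "T (t *\<^sub>R p)"]) simp
    qed
    show "c *\<^sub>R w \<in> conic hull (T ` Q)" if "0 \<le> c" "w \<in> conic hull (T ` Q)" for c w
      using conic_conic_hull that by (auto simp: conic_def)
    have "\<forall>\<^sub>F w in nhds 0. w \<in> conic hull (T ` Q) \<longrightarrow> w \<in> T ` Q"
      using eventually_conic_hull_polyhedron[OF polytope_imp_polyhedron[OF TQ] TQ0] .
    then show "\<forall>\<^sub>F w in nhds 0. w \<in> conic hull (T ` Q) \<longrightarrow> (\<exists>p\<in>P. norm p < e \<and> T p = w)"
      by eventually_elim (use a(2) in \<open>auto simp: Q_def subset_iff\<close>)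
  qed
qed

lemma polyhedron_translation_vimage:
  fixes P :: "'a::euclidean_space set"
  assumes "polyhedron P"
  shows "polyhedron {v. z + v \<in> P}"
proof -
  obtain F where F: "finite F" "P = \<Inter>F" "\<And>h. h \<in> F \<Longrightarrow> \<exists>a b. a \<noteq> 0 \<and> h = {x. a \<bullet> x \<le> b}"
    using assms(1) unfolding polyhedron_def by blast
  have "polyhedron {v. z + v \<in> h}" if h: "h \<in> F" for h
  proof -
    obtain a b where "h = {x. a \<bullet> x \<le> b}" using F(3)[OF h] by blast
    then have "{v. z + v \<in> h} = {v. a \<bullet> v \<le> b - a \<bullet> z}" by (auto simp: inner_simps)
    then show ?thesis by (simp add: polyhedron_halfspace_le)
  qed
  moreover have "{v. z + v \<in> P} = (\<Inter>h\<in>F. {v. z + v \<in> h})" using F(2) by auto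
  ultimately show ?thesis using F(1) by (metis (mono_tags, lifting) finite_imageI imageE polyhedron_Inter)
qed

section \<open>Openness and lower semicontinuity for linear maps on a polyhedron\<close>

text \<open>With \<open>z0\<close> moved to the origin, every image point lies in the cone
  \<open>K\<close>, and near 0 each point of \<open>K\<close> is the image of a small vector. This
  is where polyhedrality is stronger than convexity.\<close>

lemma polyhedron_linear_open_at:
  fixes T :: "'a::euclidean_space \<Rightarrow> 'b::euclidean_space"
  assumes P: "polyhedron P" and z0: "z0 \<in> P" and T: "linear T" and e: "0 < e"
  obtains \<delta> where "0 < \<delta>"
    "\<And>z. z \<in> P \<Longrightarrow> dist (T z) (T z0) < \<delta> \<Longrightarrow> \<exists>z'\<in>P. dist z' z0 < e \<and> T z' = T z"
proof -
  have "polyhedron {v. z0 + v \<in> P}" "0 \<in> {v. z0 + v \<in> P}"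
    using polyhedron_translation_vimage[OF P] z0 by auto
  note P0 = this
  obtain K where K: "closed K" "T ` {v. z0 + v \<in> P} \<subseteq> K"
    "\<And>c w. 0 \<le> c \<Longrightarrow> w \<in> K \<Longrightarrow> c *\<^sub>R w \<in> K"
    "\<forall>\<^sub>F w in nhds 0. w \<in> K \<longrightarrow> (\<exists>v\<in>{v. z0 + v \<in> P}. norm v < e \<and> T v = w)"
    by (rule polyhedron_linear_image_cone[OF P0 T e]) (rule that)
  obtain \<delta> where \<delta>: "0 < \<delta>"
    "\<And>w. dist w 0 < \<delta> \<Longrightarrow> w \<in> K \<longrightarrow> (\<exists>v\<in>{v. z0 + v \<in> P}. norm v < e \<and> T v = w)"
    using K(4) unfolding eventually_nhds_metric by blast
  show thesis
  proof
    show "0 < \<delta>" by fact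
    fix z assume z: "z \<in> P" "dist (T z) (T z0) < \<delta>"
    \<comment> \<open>The vector \<open>z - z0\<close> itself may be long; only its image is short.
      Membership of that image in \<open>K\<close> lets it be replaced by a short preimage
      \<open>v\<close>.\<close>
    have "z - z0 \<in> {v. z0 + v \<in> P}" using z(1) by simp
    then have "T (z - z0) \<in> K" using K(2) by blast
    moreover have "dist (T (z - z0)) 0 < \<delta>" using z(2) by (simp add: linear_diff[OF T] dist_norm)
    ultimately obtain v where "z0 + v \<in> P" "norm v < e" "T v = T (z - z0)"
      using \<delta>(2) by blast
    then show "\<exists>z'\<in>P. dist z' z0 < e \<and> T z' = T z"
      by (intro bexI[of _ "z0 + v"]) (auto simp: dist_norm linear_add[OF T] linear_diff[OF T])
  qed
qed

text \<open>The cone is applied to the joint map of objective and right-hand side. Minimality at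
  \<open>z0\<close> keeps the descent direction \<open>(- e, 0)\<close> out of this closed cone, so
  a whole ball around it is missed, and the radius of that ball is the required \<delta>.\<close>

lemma polyhedron_linear_value_lsc:
  fixes T :: "'a::euclidean_space \<Rightarrow> 'b::euclidean_space" and l :: "'a \<Rightarrow> real"
  assumes P: "polyhedron P" and z0: "z0 \<in> P" and T: "linear T" and l: "linear l"
    and min: "\<And>z. z \<in> P \<Longrightarrow> T z = T z0 \<Longrightarrow> l z0 \<le> l z" and e: "0 < e"
  obtains \<delta> where "0 < \<delta>" "\<And>z. z \<in> P \<Longrightarrow> dist (T z) (T z0) < \<delta> \<Longrightarrow> l z0 - e < l z"
proof -
  define T' where "T' = (\<lambda>v. (l v, T v))"
  have T': "linear T'"
    unfolding T'_def
    by (rule linearI) (simp_all add: linear_add[OF T] linear_cmul[OF T] linear_add[OF l] linear_cmul[OF l])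
  have "polyhedron {v. z0 + v \<in> P}" "0 \<in> {v. z0 + v \<in> P}"
    using polyhedron_translation_vimage[OF P] z0 by auto
  note P0 = this
  \<comment> \<open>Only the existence of a preimage is used below, so the radius 1 is an arbitrary
    choice.\<close>
  obtain K where K: "closed K" "T' ` {v. z0 + v \<in> P} \<subseteq> K"
    "\<And>c w. 0 \<le> c \<Longrightarrow> w \<in> K \<Longrightarrow> c *\<^sub>R w \<in> K"
    "\<forall>\<^sub>F w in nhds 0. w \<in> K \<longrightarrow> (\<exists>v\<in>{v. z0 + v \<in> P}. norm v < 1 \<and> T' v = w)"
    by (rule polyhedron_linear_image_cone[OF P0 T' zero_less_one]) (rule that)
  \<comment> \<open>A small positive multiple of \<open>(- e, 0)\<close> would be attained by some
    \<open>v\<close>, and \<open>z0 + v\<close> would have the same \<open>T\<close> and a smaller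
    \<open>l\<close> than \<open>z0\<close>.\<close>
  have "(- e, 0) \<notin> K"
  proof
    assume mem: "(- e, 0) \<in> K"
    have "((\<lambda>t::real. t *\<^sub>R (- e, 0::'b)) \<longlongrightarrow> 0 *\<^sub>R (- e, 0)) (at_right 0)" by (intro tendsto_intros)
    then have "LIM t at_right (0::real). t *\<^sub>R (- e, 0::'b) :> nhds 0" by (simp add: zero_prod_def)
    from eventually_happens'[OF trivial_limit_at_right_real
        eventually_conj[OF eventually_at_right_less eventually_compose_filterlim[OF K(4) this]]]
    obtain t :: real where t: "0 < t"
      "t *\<^sub>R (- e, 0::'b) \<in> K \<longrightarrow> (\<exists>v\<in>{v. z0 + v \<in> P}. norm v < 1 \<and> T' v = t *\<^sub>R (- e, 0))"
      by (elim exE conjE) (rule that)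
    then obtain v where v: "z0 + v \<in> P" "l v = - t * e" "T v = 0"
      using K(3)[OF _ mem, of t] by (auto simp: T'_def)
    have "l z0 \<le> l (z0 + v)" by (rule min) (use v in \<open>simp_all add: linear_add[OF T]\<close>)
    then show False using v t(1) e by (simp add: linear_add[OF l] mult_le_0_iff)
  qed
  then obtain \<delta> where \<delta>: "0 < \<delta>" "ball (- e, 0) \<delta> \<subseteq> - K"
    using K(1) open_contains_ball[of "- K"] by auto
  show thesis
  proof
    show "0 < \<delta>" by fact
    fix z assume z: "z \<in> P" "dist (T z) (T z0) < \<delta>"
    show "l z0 - e < l z"
    proof (rule ccontr)
      assume "\<not> ?thesis"
      then have t: "l (z - z0) \<le> - e" by (simp add: linear_diff[OF l])
      \<comment> \<open>This scaling makes the objective coordinate exactly \<open>- e\<close>.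
        Since \<open>c \<le> 1\<close>, the other coordinate stays within \<delta>, so the scaled
        point falls into the ball that misses \<open>K\<close>.\<close>
      define c where "c = e / (- l (z - z0))"
      have c: "0 \<le> c" "c \<le> 1" "c * l (z - z0) = - e"
        using t e by (auto simp: c_def field_simps)
      have "z - z0 \<in> {v. z0 + v \<in> P}" using z(1) by simp
      then have "c *\<^sub>R T' (z - z0) \<in> K" using K(2,3) c(1) by blast
      then have "(- e, c *\<^sub>R T (z - z0)) \<in> K" using c(3) by (simp add: T'_def)
      moreover have "dist (- e, 0) (- e, c *\<^sub>R T (z - z0)) < \<delta>"
      proof -
        have "c * norm (T (z - z0)) \<le> 1 * norm (T (z - z0))"
          using c by (intro mult_right_mono) auto
        then show ?thesis using z(2) c(1) by (simp add: dist_Pair_Pair dist_norm linear_diff[OF T])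
      qed
      ultimately show False using \<delta>(2) by (auto simp: subset_iff)
    qed
  qed
qed

section \<open>Positive definite quadratic forms and their minimizers\<close>

text \<open>Compactness gives a positive minimum on the unit sphere, and homogeneity of degree two
  carries it to all vectors.\<close>

lemma positive_definite_coercive:
  fixes L :: "'a::euclidean_space \<Rightarrow> 'a"
  assumes L: "linear L" and pos: "\<And>v. v \<noteq> 0 \<Longrightarrow> 0 < v \<bullet> L v"
  obtains m where "0 < m" "\<And>v. m * (norm v)\<^sup>2 \<le> v \<bullet> L v"
proof -
  have "continuous_on (sphere 0 1) (\<lambda>v. v \<bullet> L v)"
    by (intro continuous_intros linear_continuous_on_compose[OF _ L])
  moreover have "sphere (0::'a) 1 \<noteq> {}" by simp
  ultimately obtain w where w: "w \<in> sphere 0 1" "\<And>v. v \<in> sphere 0 1 \<Longrightarrow> w \<bullet> L w \<le> v \<bullet> L v"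
    using continuous_attains_inf[OF compact_sphere, of 0 1 "\<lambda>v. v \<bullet> L v"] by blast
  show thesis
  proof
    show "0 < w \<bullet> L w" using w(1) by (intro pos) auto
    fix v
    show "w \<bullet> L w * (norm v)\<^sup>2 \<le> v \<bullet> L v"
    proof (cases "v = 0")
      case False
      have "w \<bullet> L w \<le> (inverse (norm v) *\<^sub>R v) \<bullet> L (inverse (norm v) *\<^sub>R v)"
        by (rule w(2)) (use False in simp)
      also have "\<dots> = (v \<bullet> L v) / (norm v)\<^sup>2"
        by (simp add: linear_cmul[OF L] power2_eq_square divide_simps)
      finally show ?thesis using False by (simp add: field_simps)
    qed (simp add: linear_0[OF L])
  qed
qed

lemma ex1_arg_min_positive_definite:
  fixes L :: "'a::euclidean_space \<Rightarrow> 'a"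
  assumes L: "linear L" and pos: "\<And>v. v \<noteq> 0 \<Longrightarrow> 0 < v \<bullet> L v"
    and S: "closed S" "convex S" "S \<noteq> {}"
  shows "\<exists>!z. is_arg_min (\<lambda>z. (z - c) \<bullet> L (z - c)) (\<lambda>z. z \<in> S) z"
proof -
  let ?N = "\<lambda>z. (z - c) \<bullet> L (z - c)"
  obtain m where m: "0 < m" "\<And>v. m * (norm v)\<^sup>2 \<le> v \<bullet> L v"
    using positive_definite_coercive[OF L pos] by blast
  have cont: "continuous_on A ?N" for A
    by (intro continuous_intros linear_continuous_on_compose[OF _ L])
  obtain s where s: "s \<in> S" using S(3) by blast
  \<comment> \<open>By coercivity this ball contains every point whose value is at most that of
    \<open>s\<close>, so minimizing over the compact set \<open>B\<close> suffices.\<close>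
  define B where "B = S \<inter> cball c (sqrt (?N s / m))"
  have B: "z \<in> B" if "z \<in> S" "?N z \<le> ?N s" for z
  proof -
    have "(norm (z - c))\<^sup>2 \<le> ?N s / m"
      using m(2)[of "z - c"] that(2) m(1) by (simp add: field_simps)
    then show ?thesis using that(1) by (simp add: B_def dist_norm norm_minus_commute real_le_rsqrt)
  qed
  have "compact B" unfolding B_def by (intro closed_Int_compact S compact_cball)
  then obtain z where z: "z \<in> B" "\<And>y. y \<in> B \<Longrightarrow> ?N z \<le> ?N y"
    using continuous_attains_inf[OF _ _ cont, of B] B[OF s] by blast
  have zmin: "is_arg_min ?N (\<lambda>z. z \<in> S) z"
    unfolding is_arg_min_linorder
  proof (intro conjI allI impI)
    show "z \<in> S" using z(1) by (simp add: B_def)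
    show "?N z \<le> ?N y" if "y \<in> S" for y
      using z(2)[of y] z(2)[OF B[OF s]] B[OF that] by linarith
  qed
  moreover have "x = y" if x: "is_arg_min ?N (\<lambda>z. z \<in> S) x" and y: "is_arg_min ?N (\<lambda>z. z \<in> S) y" for x y
  proof (rule ccontr)
    assume "x \<noteq> y"
    let ?w = "(1 / 2) *\<^sub>R x + (1 / 2) *\<^sub>R y"
    have "?w \<in> S" using convexD[OF S(2)] x y by (auto simp: is_arg_min_def)
    then have "?N x \<le> ?N ?w" "?N y \<le> ?N ?w"
      using x y by (auto simp: is_arg_min_linorder)
    \<comment> \<open>Parallelogram identity: the midpoint of two distinct minimizers would have a
      strictly smaller value.\<close>
    moreover have "?N ?w = (?N x + ?N y) / 2 - ((x - y) \<bullet> L (x - y)) / 4"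
    proof -
      have "((1 / 2) *\<^sub>R (v + w)) \<bullet> L ((1 / 2) *\<^sub>R (v + w))
          = (v \<bullet> L v + w \<bullet> L w) / 2 - (v - w) \<bullet> L (v - w) / 4" for v w
        by (simp add: linear_cmul[OF L] linear_add[OF L] linear_diff[OF L] inner_add_left
            inner_add_right inner_diff_left inner_diff_right field_simps)
      from this[of "x - c" "y - c"]
      have "?N x / 2 + ?N y / 2 - ((x - y) \<bullet> L (x - y)) / 4
          = ((1 / 2) *\<^sub>R (x - c + (y - c))) \<bullet> L ((1 / 2) *\<^sub>R (x - c + (y - c)))"
        by (simp add: add_divide_distrib)
      also have "(1 / 2) *\<^sub>R (x - c + (y - c)) = ?w - c"
        by (simp add: algebra_simps flip: scaleR_add_left)
      finally show ?thesis by (simp only: add_divide_distrib)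
    qed
    moreover have "0 < (x - y) \<bullet> L (x - y)" using \<open>x \<noteq> y\<close> by (intro pos) simp
    ultimately show False by argo
  qed
  ultimately show ?thesis by blast
qed

section \<open>Convergence of weighted optima to the lexicographic optimum\<close>

text \<open>The sign condition on the slacks makes their squares monotone in them. Minimizing a
  squared slack is then a linear program over \<open>P\<close>, and a limit of squares determines a
  limit of slacks.\<close>

lemma lexicographic_limit:
  fixes P :: "('a::euclidean_space \<times> real \<times> real) set" and L :: "'a \<Rightarrow> 'a"
    and u :: "real \<Rightarrow> 'a" and d1 d2 :: "real \<Rightarrow> real"
  assumes P: "polyhedron P"
    and sgn: "\<And>v a b. (v, a, b) \<in> P \<Longrightarrow> 0 \<le> a \<and> b \<le> 0"
    and L: "linear L" and sym: "\<And>v w. v \<bullet> L w = L v \<bullet> w"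
    and pos: "\<And>v. v \<noteq> 0 \<Longrightarrow> 0 < v \<bullet> L v"
    and z0: "(us, d1s, d2s) \<in> P"
    and min2: "\<And>v a b. (v, a, b) \<in> P \<Longrightarrow> d2s\<^sup>2 \<le> b\<^sup>2"
    and min1: "\<And>v a. (v, a, d2s) \<in> P \<Longrightarrow> d1s\<^sup>2 \<le> a\<^sup>2"
    and min0: "\<And>v. (v, d1s, d2s) \<in> P \<Longrightarrow> (us - k) \<bullet> L (us - k) \<le> (v - k) \<bullet> L (v - k)"
    and mem: "\<And>q. 0 < q \<Longrightarrow> (u q, d1 q, d2 q) \<in> P"
    and opt: "\<And>q v a b. 0 < q \<Longrightarrow> (v, a, b) \<in> P \<Longrightarrow>
      (u q - k) \<bullet> L (u q - k) + q * (d1 q)\<^sup>2 + q\<^sup>2 * (d2 q)\<^sup>2 \<le> (v - k) \<bullet> L (v - k) + q * a\<^sup>2 + q\<^sup>2 * b\<^sup>2"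
  shows "((\<lambda>q. (u q, d1 q, d2 q)) \<longlongrightarrow> (us, d1s, d2s)) at_top"
proof -
  define N where "N v = v \<bullet> L v" for v
  define Ns where "Ns = N (us - k)"
  obtain m where m: "0 < m" "\<And>v. m * (norm v)\<^sup>2 \<le> N v"
    using positive_definite_coercive[OF L pos] unfolding N_def by blast
  have N0: "0 \<le> N v" for v using m by (metis mult_nonneg_nonneg less_imp_le order_trans zero_le_power2)
  have N_add: "N (v + w) = N v + 2 * (L v \<bullet> w) + N w" for v w
    using sym[of v w] inner_commute[of w "L v"]
    by (simp add: N_def linear_add[OF L] inner_add_left inner_add_right)
  have q0: "\<forall>\<^sub>F q::real in at_top. 0 < q" by (rule eventually_gt_at_top)
  have inv: "((\<lambda>q::real. inverse q) \<longlongrightarrow> 0) at_top"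
    by (rule tendsto_inverse_0_at_top[OF filterlim_ident])
  \<comment> \<open>Both bounds test the optimum at \<open>q\<close> against the safety-first point.
    The first drops the nonnegative cost and \<open>d1\<close> term; the second drops the cost and
    cancels the \<open>d2\<close> terms by \<open>min2\<close>.\<close>
  have d2_sq: "(d2 q)\<^sup>2 \<le> d2s\<^sup>2 + (Ns * inverse q + d1s\<^sup>2) * inverse q"
    and d1_sq: "(d1 q)\<^sup>2 \<le> d1s\<^sup>2 + Ns * inverse q" if q: "0 < q" for q
  proof -
    have *: "N (u q - k) + q * (d1 q)\<^sup>2 + q\<^sup>2 * (d2 q)\<^sup>2 \<le> Ns + q * d1s\<^sup>2 + q\<^sup>2 * d2s\<^sup>2"
      using opt[OF q z0] by (simp add: N_def Ns_def)
    have "0 \<le> q * (d1 q)\<^sup>2" using q by simp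
    with * have "q\<^sup>2 * (d2 q)\<^sup>2 \<le> Ns + q * d1s\<^sup>2 + q\<^sup>2 * d2s\<^sup>2" using N0[of "u q - k"] by linarith
    then show "(d2 q)\<^sup>2 \<le> d2s\<^sup>2 + (Ns * inverse q + d1s\<^sup>2) * inverse q"
      using q by (simp add: field_simps power2_eq_square)
    have "q\<^sup>2 * d2s\<^sup>2 \<le> q\<^sup>2 * (d2 q)\<^sup>2" using min2[OF mem[OF q]] by (intro mult_left_mono) auto
    with * have "q * (d1 q)\<^sup>2 \<le> Ns + q * d1s\<^sup>2" using N0[of "u q - k"] by linarith
    then show "(d1 q)\<^sup>2 \<le> d1s\<^sup>2 + Ns * inverse q" using q by (simp add: field_simps)
  qed
  have s: "0 \<le> d1s" "d2s \<le> 0" using sgn[OF z0] by auto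

  have d2: "(d2 \<longlongrightarrow> d2s) at_top"
  proof -
    have "((\<lambda>q. d2s\<^sup>2 + (Ns * inverse q + d1s\<^sup>2) * inverse q) \<longlongrightarrow> d2s\<^sup>2 + (Ns * 0 + d1s\<^sup>2) * 0) at_top"
      by (intro tendsto_intros inv)
    then have upper: "((\<lambda>q. d2s\<^sup>2 + (Ns * inverse q + d1s\<^sup>2) * inverse q) \<longlongrightarrow> d2s\<^sup>2) at_top" by simp
    have "((\<lambda>q. (d2 q)\<^sup>2) \<longlongrightarrow> d2s\<^sup>2) at_top"
    proof (rule tendsto_sandwich[OF _ _ tendsto_const upper])
      show "\<forall>\<^sub>F q in at_top. d2s\<^sup>2 \<le> (d2 q)\<^sup>2" using q0 by eventually_elim (rule min2[OF mem])
      show "\<forall>\<^sub>F q in at_top. (d2 q)\<^sup>2 \<le> d2s\<^sup>2 + (Ns * inverse q + d1s\<^sup>2) * inverse q"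
        using q0 by eventually_elim (rule d2_sq)
    qed
    \<comment> \<open>The slacks \<open>d2 q\<close> and \<open>d2s\<close> are nonpositive, so they
      are the negative roots of their squares.\<close>
    from tendsto_minus[OF tendsto_real_sqrt[OF this]]
    have "((\<lambda>q. - sqrt ((d2 q)\<^sup>2)) \<longlongrightarrow> d2s) at_top" using s(2) by (simp only: real_sqrt_abs abs_of_nonpos minus_minus)
    moreover have "\<forall>\<^sub>F q in at_top. - sqrt ((d2 q)\<^sup>2) = d2 q"
      using q0 by eventually_elim (use sgn[OF mem] in simp)
    ultimately show ?thesis by (rule Lim_transform_eventually)
  qed

  have d1: "(d1 \<longlongrightarrow> d1s) at_top"
  proof (rule order_tendstoI)
    fix a assume "a < d1s"
    then have e: "0 < d1s - a" by simp
    have T: "linear (\<lambda>z::'a \<times> real \<times> real. snd (snd z))" "linear (\<lambda>z::'a \<times> real \<times> real. fst (snd z))"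
      by (auto intro: linearI)
    \<comment> \<open>The linear program minimizes the first slack with the second as right-hand
      side; the signs turn \<open>min1\<close> into a statement without squares.\<close>
    have min: "fst (snd (us, d1s, d2s)) \<le> fst (snd z)"
      if "z \<in> P" "snd (snd z) = snd (snd (us, d1s, d2s))" for z
    proof -
      have "(fst z, fst (snd z), d2s) \<in> P" using that by (metis prod.collapse snd_conv)
      then show ?thesis using min1 sgn by (auto intro: power2_le_imp_le)
    qed
    obtain \<delta> where \<delta>: "0 < \<delta>" "\<And>z. z \<in> P \<Longrightarrow> dist (snd (snd z)) (snd (snd (us, d1s, d2s))) < \<delta> \<Longrightarrow>
        fst (snd (us, d1s, d2s)) - (d1s - a) < fst (snd z)"
      by (rule polyhedron_linear_value_lsc[OF P z0 T min e]) (assumption+, rule that)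
    have "\<forall>\<^sub>F q in at_top. dist (d2 q) d2s < \<delta>" using d2 \<delta>(1) by (rule tendstoD)
    with q0 show "\<forall>\<^sub>F q in at_top. a < d1 q"
      by eventually_elim (use \<delta>(2)[OF mem] in simp)
  next
    fix a assume a: "d1s < a"
    have "((\<lambda>q. d1s\<^sup>2 + Ns * inverse q) \<longlongrightarrow> d1s\<^sup>2 + Ns * 0) at_top"
      by (intro tendsto_intros inv)
    moreover have "d1s\<^sup>2 + Ns * 0 < a\<^sup>2" using a s(1) by (simp add: power_strict_mono)
    ultimately have "\<forall>\<^sub>F q in at_top. d1s\<^sup>2 + Ns * inverse q < a\<^sup>2" by (rule order_tendstoD)
    with q0 show "\<forall>\<^sub>F q in at_top. d1 q < a"
    proof eventually_elim
      case (elim q)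
      then have "(d1 q)\<^sup>2 < a\<^sup>2" using d1_sq by fastforce
      then show ?case by (rule power2_less_imp_less) (use a s in simp)
    qed
  qed

  \<comment> \<open>First-order optimality: along the segment from \<open>us\<close> to
    \<open>v\<close> the cost changes by \<open>t * (2 * ?s + t * N (v - us))\<close>. Dividing by
    \<open>t\<close> and letting it tend to 0 leaves the directional derivative.\<close>
  have gradient_nonneg: "0 \<le> L (us - k) \<bullet> (v - us)" if v: "(v, d1s, d2s) \<in> P" for v
  proof -
    let ?s = "L (us - k) \<bullet> (v - us)"
    have "0 \<le> 2 * ?s + t * N (v - us)" if t: "0 < t" "t < 1" for t
    proof -
      have "(1 - t) *\<^sub>R (us, d1s, d2s) + t *\<^sub>R (v, d1s, d2s) \<in> P"
        using convexD_alt[OF polyhedron_imp_convex[OF P] z0 v, of t] t by simp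
      moreover have "(1 - t) *\<^sub>R (us, d1s, d2s) + t *\<^sub>R (v, d1s, d2s) = (us + t *\<^sub>R (v - us), d1s, d2s)"
        by (simp add: algebra_simps)
      ultimately have "N (us - k) \<le> N (us + t *\<^sub>R (v - us) - k)"
        using min0 by (simp add: N_def)
      also have "us + t *\<^sub>R (v - us) - k = (us - k) + t *\<^sub>R (v - us)" by simp
      also have "N \<dots> = N (us - k) + t * (2 * ?s + t * N (v - us))"
        unfolding N_add by (simp add: N_def linear_cmul[OF L] distrib_left)
      finally show ?thesis using t by (simp add: zero_le_mult_iff)
    qed
    then have "\<forall>\<^sub>F t in at_right 0. 0 \<le> 2 * ?s + t * N (v - us)"
      using eventually_at_right_real[of 0 1] by (auto elim: eventually_mono)
    moreover have "((\<lambda>t. 2 * ?s + t * N (v - us)) \<longlongrightarrow> 2 * ?s + 0 * N (v - us)) (at_right 0)"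
      by (intro tendsto_intros)
    ultimately have "0 \<le> 2 * ?s + 0 * N (v - us)"
      by (intro tendsto_lowerbound[of _ _ "at_right (0::real)"]) auto
    then show ?thesis by simp
  qed

  have "(u \<longlongrightarrow> us) at_top"
  proof (rule tendstoI)
    fix e :: real assume e: "0 < e"
    \<comment> \<open>Two errors of size \<eta> arise below, one from the cost of the competitor and
      one from the linear term; together they make \<open>m * e\<^sup>2\<close>.\<close>
    define \<eta> where "\<eta> = m * e\<^sup>2 / 2"
    have \<eta>: "0 < \<eta>" using m(1) e by (simp add: \<eta>_def)
    have T: "linear (snd :: 'a \<times> real \<times> real \<Rightarrow> _)" by (rule linear_snd)
    have l: "linear (\<lambda>z::'a \<times> real \<times> real. 2 * (L (us - k) \<bullet> fst z))"
      by (auto intro!: linearI simp: inner_add_right algebra_simps)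
    have "continuous_on UNIV (\<lambda>v. N (v - k))"
      unfolding N_def by (intro continuous_intros linear_continuous_on_compose[OF _ L])
    then have "isCont (\<lambda>v. N (v - k)) us" by (simp add: continuous_on_eq_continuous_at)
    then obtain r where r: "0 < r" "\<And>v. dist v us < r \<Longrightarrow> dist (N (v - k)) Ns < \<eta>"
      unfolding continuous_at_eps_delta Ns_def using \<eta> by (auto simp: dist_norm)
    obtain \<delta>1 where \<delta>1: "0 < \<delta>1" "\<And>z. z \<in> P \<Longrightarrow> dist (snd z) (snd (us, d1s, d2s)) < \<delta>1 \<Longrightarrow>
        \<exists>z'\<in>P. dist z' (us, d1s, d2s) < r \<and> snd z' = snd z"
      by (rule polyhedron_linear_open_at[OF P z0 T r(1)]) (rule that)
    \<comment> \<open>By the first-order condition, \<open>us\<close> minimizes the linearized cost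
      among inputs with slacks \<open>(d1s, d2s)\<close>, so this linear program is lower
      semicontinuous there.\<close>
    have min: "2 * (L (us - k) \<bullet> fst (us, d1s, d2s)) \<le> 2 * (L (us - k) \<bullet> fst z)"
      if "z \<in> P" "snd z = snd (us, d1s, d2s)" for z
      using gradient_nonneg[of "fst z"] that by (cases z) (simp add: inner_diff_right)
    obtain \<delta>2 where \<delta>2: "0 < \<delta>2" "\<And>z. z \<in> P \<Longrightarrow> dist (snd z) (snd (us, d1s, d2s)) < \<delta>2 \<Longrightarrow>
        2 * (L (us - k) \<bullet> fst (us, d1s, d2s)) - \<eta> < 2 * (L (us - k) \<bullet> fst z)"
      by (rule polyhedron_linear_value_lsc[OF P z0 T l min \<eta>]) (assumption+, rule that)
    have "((\<lambda>q. (d1 q, d2 q)) \<longlongrightarrow> (d1s, d2s)) at_top" by (intro tendsto_Pair d1 d2)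
    then have "\<forall>\<^sub>F q in at_top. dist (d1 q, d2 q) (d1s, d2s) < min \<delta>1 \<delta>2"
      using \<delta>1(1) \<delta>2(1) by (intro tendstoD) auto
    with q0 show "\<forall>\<^sub>F q in at_top. dist (u q) us < e"
    proof eventually_elim
      case (elim q)
      \<comment> \<open>The competitor \<open>v\<close> shares the slacks of the optimum, so the
        penalty terms cancel in \<open>opt\<close> however large \<open>q\<close> is, and only the
        costs are compared.\<close>
      obtain v where v: "(v, d1 q, d2 q) \<in> P" "dist (v, d1 q, d2 q) (us, d1s, d2s) < r"
        using \<delta>1(2)[OF mem[OF elim(1)]] elim(2) by force
      have "dist v us < r"
        using v(2) dist_fst_le[of "(v, d1 q, d2 q)" "(us, d1s, d2s)"] by simp
      then have "N (v - k) < Ns + \<eta>" using r(2) by (fastforce simp: dist_real_def)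
      moreover have "N (u q - k) \<le> N (v - k)" using opt[OF elim(1) v(1)] by (simp add: N_def)
      moreover have "N (u q - k) = Ns + 2 * (L (us - k) \<bullet> (u q - us)) + N (u q - us)"
        using N_add[of "us - k" "u q - us"] by (simp add: Ns_def)
      moreover have "- \<eta> < 2 * (L (us - k) \<bullet> (u q - us))"
        using \<delta>2(2)[OF mem[OF elim(1)]] elim(2) by (simp add: inner_diff_right)
      ultimately have "m * (norm (u q - us))\<^sup>2 < 2 * \<eta>" using m(2)[of "u q - us"] by linarith
      then have "(norm (u q - us))\<^sup>2 < e\<^sup>2" using m(1) by (simp add: \<eta>_def)
      then have "norm (u q - us) < e" by (rule power2_less_imp_less) (use e in simp)
      then show ?case by (simp add: dist_norm)
    qed
  qed
  then show ?thesis by (intro tendsto_Pair d1 d2)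
qed

section \<open>Application to the CLF-CBF programs\<close>

lemma polyhedron_feasible:
  fixes A :: "real ^ 'm ^ 'p"
  shows "polyhedron {(u, d1, d2). feasible f g V h lam gam (input_set A b) x u d1 d2}"
proof -
  let ?F = "\<lambda>i. {z :: (real ^ 'm) \<times> real \<times> real. (A $ i, 0, 0) \<bullet> z \<le> b $ i}"
  have "polyhedron (\<Inter> (range ?F))"
    by (rule polyhedron_Inter) (auto simp: polyhedron_halfspace_le)
  moreover have "{(u, d1, d2). feasible f g V h lam gam (input_set A b) x u d1 d2}
    = {z. (lie_g g V x, - 1, 0) \<bullet> z \<le> - (lie_f f V x + lam * V x)}
      \<inter> {z. (- lie_g g h x, 0, 1) \<bullet> z \<le> lie_f f h x + gam * h x} \<inter> \<Inter> (range ?F)"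
    by (auto simp: feasible_def input_set_def less_eq_vec_def matrix_vector_mul_component algebra_simps)
  ultimately show ?thesis by (simp only: polyhedron_Int polyhedron_halfspace_le)
qed

text \<open>Raising a negative \<open>d1s\<close> to 0, or lowering a positive \<open>d2s\<close> to
  0, relaxes the constraint and shrinks the square.\<close>

lemma safety_first_solution_signs:
  assumes "safety_first_solution f g V h lam gam U H k x (us, d1s, d2s)"
  shows "0 \<le> d1s" "d2s \<le> 0"
proof -
  obtain u d1 where 1: "feasible f g V h lam gam U x u d1 d2s"
    "\<And>u' a b. feasible f g V h lam gam U x u' a b \<Longrightarrow> d2s\<^sup>2 \<le> b\<^sup>2"
    using assms unfolding safety_first_solution_def is_arg_min_linorder by auto
  obtain u' where 2: "feasible f g V h lam gam U x u' d1s d2s"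
    "\<And>v a. feasible f g V h lam gam U x v a d2s \<Longrightarrow> d1s\<^sup>2 \<le> a\<^sup>2"
    using assms unfolding safety_first_solution_def is_arg_min_linorder by auto
  show "0 \<le> d1s"
  proof (rule ccontr)
    assume "\<not> 0 \<le> d1s"
    with 2(1) have "feasible f g V h lam gam U x u' 0 d2s" by (simp add: feasible_def)
    from 2(2)[OF this] show False using \<open>\<not> 0 \<le> d1s\<close> by simp
  qed
  show "d2s \<le> 0"
  proof (rule ccontr)
    assume "\<not> d2s \<le> 0"
    with 1(1) have "feasible f g V h lam gam U x u d1 0" by (simp add: feasible_def)
    from 1(2)[OF this] show False using \<open>\<not> d2s \<le> 0\<close> by simp
  qed
qed

text \<open>Resetting a slack of the wrong sign to 0, with everything else fixed, stays feasible and
  strictly lowers the objective because \<open>q\<close> is positive.\<close>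

lemma unified_solution_signs:
  assumes q: "0 < q" and sol: "unified_solution f g V h lam gam U H k x q (u, d1, d2)"
  shows "0 \<le> d1" "d2 \<le> 0"
proof -
  have feas: "feasible f g V h lam gam U x u d1 d2"
    and opt: "\<And>u' a b. feasible f g V h lam gam U x u' a b \<Longrightarrow>
      control_cost H k x u + q * d1\<^sup>2 + q\<^sup>2 * d2\<^sup>2 \<le> control_cost H k x u' + q * a\<^sup>2 + q\<^sup>2 * b\<^sup>2"
    using sol unfolding unified_solution_def is_arg_min_linorder by auto
  show "0 \<le> d1"
  proof (rule ccontr)
    assume "\<not> 0 \<le> d1"
    with feas have "feasible f g V h lam gam U x u 0 d2" by (simp add: feasible_def)
    from opt[OF this] have "q * d1\<^sup>2 \<le> 0" by simp
    then show False using q \<open>\<not> 0 \<le> d1\<close> by (simp add: mult_le_0_iff)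
  qed
  show "d2 \<le> 0"
  proof (rule ccontr)
    assume "\<not> d2 \<le> 0"
    with feas have "feasible f g V h lam gam U x u d1 0" by (simp add: feasible_def)
    from opt[OF this] have "q\<^sup>2 * d2\<^sup>2 \<le> 0" by simp
    then show False using q \<open>\<not> d2 \<le> 0\<close> by (simp add: mult_le_0_iff)
  qed
qed

lemma symmetric_positive_definiteD:
  assumes "symmetric_positive_definite H"
  shows "v \<bullet> (H *v w) = (H *v v) \<bullet> w" "v \<noteq> 0 \<Longrightarrow> 0 < v \<bullet> (H *v v)"
proof -
  show "v \<bullet> (H *v w) = (H *v v) \<bullet> w"
    using assms by (metis dot_lmul_matrix symmetric_positive_definite_def transpose_matrix_vector)
  show "v \<noteq> 0 \<Longrightarrow> 0 < v \<bullet> (H *v v)"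
    using assms by (simp add: symmetric_positive_definite_def)
qed

text \<open>In the joint variable the objective is a quadratic form centred at
  \<open>(k x, 0, 0)\<close> with block-diagonal operator \<open>L\<close>, which positive weights
  make positive definite.\<close>

lemma ex1_unified_solution:
  fixes A :: "real ^ 'm ^ 'p"
  assumes H: "symmetric_positive_definite H" and U: "input_set A b \<noteq> {}" and q: "0 < q"
  shows "\<exists>!z. unified_solution f g V h lam gam (input_set A b) H k x q z"
proof -
  let ?S = "{(u, d1, d2). feasible f g V h lam gam (input_set A b) x u d1 d2}"
  define L :: "(real ^ 'm) \<times> real \<times> real \<Rightarrow> (real ^ 'm) \<times> real \<times> real"
    where "L = (\<lambda>(u, d1, d2). (H *v u, q * d1, q\<^sup>2 * d2))"
  have "\<exists>!z. is_arg_min (\<lambda>z. (z - (k x, 0, 0)) \<bullet> L (z - (k x, 0, 0))) (\<lambda>z. z \<in> ?S) z"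
  proof (rule ex1_arg_min_positive_definite)
    show "linear L"
      by (rule linearI) (auto simp: L_def matrix_vector_right_distrib
          linear_cmul[OF matrix_vector_mul_linear] algebra_simps)
    show "0 < v \<bullet> L v" if v: "v \<noteq> 0" for v
    proof -
      obtain u d1 d2 where [simp]: "v = (u, d1, d2)" by (cases v)
      have nonneg: "0 \<le> u \<bullet> (H *v u)"
        using symmetric_positive_definiteD(2)[OF H, of u] by (cases "u = 0") auto
      have "v \<bullet> L v = u \<bullet> (H *v u) + (q * d1\<^sup>2 + q\<^sup>2 * d2\<^sup>2)"
        by (simp add: L_def power2_eq_square)
      also have "0 < \<dots>"
      proof (cases "u = 0")
        case True
        then have "d1 \<noteq> 0 \<or> d2 \<noteq> 0" using v by (auto simp: zero_prod_def)
        then have "0 < q * d1\<^sup>2 + q\<^sup>2 * d2\<^sup>2" using q by (auto intro: add_pos_nonneg add_nonneg_pos)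
        with nonneg show ?thesis by linarith
      next
        case False
        then show ?thesis
          using symmetric_positive_definiteD(2)[OF H] q by (intro add_pos_nonneg) auto
      qed
      finally show ?thesis .
    qed
    have S: "polyhedron ?S" by (rule polyhedron_feasible)
    show "closed ?S" using S by (rule polyhedron_imp_closed)
    show "convex ?S" using S by (rule polyhedron_imp_convex)
    obtain u where "u \<in> input_set A b" using U by blast
    \<comment> \<open>Any admissible input becomes feasible once both slack constraints hold with
      equality.\<close>
    then have "(u, lie_f f V x + lie_g g V x \<bullet> u + lam * V x,
        lie_f f h x + lie_g g h x \<bullet> u + gam * h x) \<in> ?S"
      by (simp add: feasible_def)
    then show "?S \<noteq> {}" by blast
  qed
  moreover have "(z - (k x, 0, 0)) \<bullet> L (z - (k x, 0, 0))
      = (case z of (u, d1, d2) \<Rightarrow> control_cost H k x u + q * d1\<^sup>2 + q\<^sup>2 * d2\<^sup>2)" for z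
    by (cases z) (simp add: L_def control_cost_def power2_eq_square)
  ultimately show ?thesis
    by (simp add: unified_solution_def)
qed

theorem theorem1:
  fixes f :: "real ^ 'n \<Rightarrow> real ^ 'n"
    and g :: "real ^ 'n \<Rightarrow> real ^ 'm ^ 'n"
    and V h :: "real ^ 'n \<Rightarrow> real"
    and k :: "real ^ 'n \<Rightarrow> real ^ 'm"
    and A :: "real ^ 'm ^ 'p" and b :: "real ^ 'p"
    and H :: "real ^ 'm ^ 'm"
    and lam gam :: real
    and x :: "real ^ 'n"
    and us :: "real ^ 'm" and d1s d2s :: real
  assumes "local_lipschitz (UNIV :: real set) UNIV (\<lambda>_. f)"
    and "local_lipschitz (UNIV :: real set) UNIV (\<lambda>_. g)"
    and "continuously_differentiable V" and "continuously_differentiable h"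
    and "symmetric_positive_definite H"
    and "lam > 0" and "gam > 0"
    and "input_set A b \<noteq> {}"
    and "safety_first_solution f g V h lam gam (input_set A b) H k x (us, d1s, d2s)"
  shows "(\<forall>q>0. \<exists>!z. unified_solution f g V h lam gam (input_set A b) H k x q z) \<and>
    (\<forall>z. (\<forall>q>0. unified_solution f g V h lam gam (input_set A b) H k x q (z q)) \<longrightarrow>
      (z \<longlongrightarrow> (us, d1s, d2s)) at_top)"
proof (intro conjI allI impI)
  fix q :: real assume "0 < q"
  then show "\<exists>!z. unified_solution f g V h lam gam (input_set A b) H k x q z"
    using assms by (intro ex1_unified_solution)
next
  fix z assume z: "\<forall>q>0. unified_solution f g V h lam gam (input_set A b) H k x q (z q)"
  let ?feas = "feasible f g V h lam gam (input_set A b) x"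
  \<comment> \<open>The two sign halfspaces supply the sign condition of
    \<open>lexicographic_limit\<close>. The safety-first point and all weighted optima satisfy them,
    and minimality passes to the smaller set.\<close>
  define P where "P = {(u, d1, d2). ?feas u d1 d2} \<inter> {z. (0, - 1, 0) \<bullet> z \<le> 0} \<inter> {z. (0, 0, 1) \<bullet> z \<le> 0}"
  have P_iff: "(u, d1, d2) \<in> P \<longleftrightarrow> ?feas u d1 d2 \<and> 0 \<le> d1 \<and> d2 \<le> 0" for u d1 d2
    by (simp add: P_def)
  define u d1 d2 where "u q = fst (z q)" and "d1 q = fst (snd (z q))" and "d2 q = snd (snd (z q))" for q
  have sol: "unified_solution f g V h lam gam (input_set A b) H k x q (u q, d1 q, d2 q)" if "0 < q" for q
    using z that by (simp add: u_def d1_def d2_def)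
  have "((\<lambda>q. (u q, d1 q, d2 q)) \<longlongrightarrow> (us, d1s, d2s)) at_top"
  proof (rule lexicographic_limit[where P = P and L = "(*v) H" and k = "k x"])
    show "polyhedron P"
      unfolding P_def by (simp only: polyhedron_Int polyhedron_feasible polyhedron_halfspace_le)
    show "linear ((*v) H)" by (rule matrix_vector_mul_linear)
    show "v \<bullet> (H *v w) = (H *v v) \<bullet> w" for v w
      using assms(5) by (rule symmetric_positive_definiteD)
    show "v \<noteq> 0 \<Longrightarrow> 0 < v \<bullet> (H *v v)" for v
      using assms(5) by (rule symmetric_positive_definiteD)
    show "(v, a, b) \<in> P \<Longrightarrow> 0 \<le> a \<and> b \<le> 0" for v a b by (simp add: P_iff)
    show "(us, d1s, d2s) \<in> P"
      using assms(9) safety_first_solution_signs[OF assms(9)]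
      by (simp add: P_iff safety_first_solution_def is_arg_min_linorder)
    show "d2s\<^sup>2 \<le> b\<^sup>2" if "(v, a, b) \<in> P" for v a b
      using assms(9) that by (auto simp: P_iff safety_first_solution_def is_arg_min_linorder)
    show "d1s\<^sup>2 \<le> a\<^sup>2" if "(v, a, d2s) \<in> P" for v a
      using assms(9) that by (auto simp: P_iff safety_first_solution_def is_arg_min_linorder)
    show "(us - k x) \<bullet> (H *v (us - k x)) \<le> (v - k x) \<bullet> (H *v (v - k x))" if "(v, d1s, d2s) \<in> P" for v
      using assms(9) that
      by (auto simp: P_iff safety_first_solution_def is_arg_min_linorder control_cost_def)
    show "(u q, d1 q, d2 q) \<in> P" if "0 < q" for q
      using sol[OF that] unified_solution_signs[OF that sol[OF that]]
      by (simp add: P_iff unified_solution_def is_arg_min_linorder)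
    show "(u q - k x) \<bullet> (H *v (u q - k x)) + q * (d1 q)\<^sup>2 + q\<^sup>2 * (d2 q)\<^sup>2
        \<le> (v - k x) \<bullet> (H *v (v - k x)) + q * a\<^sup>2 + q\<^sup>2 * b\<^sup>2" if "0 < q" "(v, a, b) \<in> P" for q v a b
      using sol[OF that(1)] that(2)
      by (auto simp: P_iff unified_solution_def is_arg_min_linorder control_cost_def)
  qed
  then show "(z \<longlongrightarrow> (us, d1s, d2s)) at_top" by (simp add: u_def d1_def d2_def)
qed

end
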